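(* Assume that for every $t\in\mathbb{N}_0$: (1) for each fixed $z\in\mathcal{Z}_t$ the map $x\mapsto \ell_t(x,z)$ is $\alpha_t$-strongly convex, with $\alpha_t>0$; (2) $x\mapsto\nabla_x\ell_t(x,z)$ is $\beta_t$-Lipschitz continuous for all $z\in\mathcal{Z}_t$, and $z\mapsto\nabla_x\ell_t(x,z)$ is $\beta_t$-Lipschitz continuous for all $x\in\mathbb{R}^d$; (3) there is $\varepsilon_t>0$ such that $W_1(D_t(x),D_t(x'))\le\varepsilon_t\|x-x'\|$ for all $x,x'\in\mathbb{R}^d$; (4) $C_t\subseteq\mathbb{R}^d$ is closed and convex; (5) $\varepsilon_t\beta_t/\alpha_t<1$. Let $\eta_t>0$ be stepsizes, let $\{x_t\}_{t\in\mathbb{N}_0}$ be a sequence generated by the online projected gradient descent $$x_{t+1}=\mathrm{proj}_{C_t}\big(x_t-\eta_t\nabla f_t(x_t,D_t(x_t))\big),$$ and let $\{\bar x_t\}_{t\in\mathbb{N}_0}$ be the (unique) sequence of performatively stable points. Put $e_t:=\|x_t-\bar x_t\|$, $\varphi_t:=\|\bar x_{t+1}-\bar x_t\|$ and $\rho_t:=\max\{|1-\eta_t\alpha_t|,|1-\eta_t\beta_t|\}$. Then for all $t\in\mathbb{N}_0$ $$e_{t+1}\le a_t e_0+\sum_{i=0}^t b_i\varphi_i,$$ where $a_t:=\prod_{i=0}^t(\rho_i+\eta_i\beta_i\varepsilon_i)$, $b_i:=1$ if $i=t$, and $b_i:=\prod_{k=i+1}^t(\rho_k+\eta_k\beta_k\varepsilon_k)$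 if $i\ne t$ (so $b_i$ depends also on $t$). Moreover, if for some $r\in(0,1)$ $$\eta_t\in\Big[\frac{1-r}{\alpha_t+\beta_t\varepsilon_t},\ \frac{1+r}{\beta_t(1+\varepsilon_t)}\Big]\quad\text{for all }t\in\mathbb{N}_0,$$ then $\tilde\lambda:=\sup_{t\ge0}\{\rho_t+\eta_t\beta_t\varepsilon_t\}\le r$ and $$\limsup_{t\to+\infty}e_t\le(1-\tilde\lambda)^{-1}\tilde\varphi,\qquad\text{where }\tilde\varphi:=\sup_{t\ge0}\{\varphi_t\}.$$
   Context: $\|\cdot\|$ is the Euclidean norm on $\mathbb{R}^d$, and $\mathrm{proj}_C(y)=\arg\min_{v\in C}\|y-v\|$ is the Euclidean projection onto a closed convex set $C$. $M$ is a complete separable metric space with its Borel $\sigma$-algebra, and $\mathcal{P}(M)$ is the set of Radon probability measures on $M$ with finite first moment. The Wasserstein-1 distance is $W_1(\mu,\nu)=\sup_{g}\{\mathbb{E}_{z\sim\mu}[g(z)]-\mathbb{E}_{z\sim\nu}[g(z)]\}$, the supremum being over 1-Lipschitz functions $g:M\to\mathbb{R}$. For each $t\in\mathbb{N}_0=\{0,1,2,\dots\}$ there are given a distributional map $D_t:\mathbb{R}^d\to\mathcal{P}(M)$, a constraint set $C_t\subseteq\mathbb{R}^d$, and a loss function $\ell_t:\mathbb{R}^d\times\mathcal{Z}_t\to\mathbb{R}$, where $\mathcal{Z}_t\subseteq M$, the set in which the random variable $z$ takes its values, is the union of the supports of $D_t(x)$ over all $x\in C_t$. For $x\in\mathbb{R}^d$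 and $\nu\in\mathcal{P}(M)$ set $f_t(x,\nu):=\mathbb{E}_{z\sim\nu}[\ell_t(x,z)]$; $\nabla f_t(x,\nu)$ denotes its gradient with respect to $x$. Expectation and gradient may be interchanged, i.e. $\nabla f_t(x,\nu)=\mathbb{E}_{z\sim\nu}[\nabla_x\ell_t(x,z)]$. A performatively stable point at time $t$ is a point $\bar x_t\in\arg\min_{x\in C_t}\mathbb{E}_{z\sim D_t(\bar x_t)}[\ell_t(x,z)]$. Under hypotheses (1)–(5) of the claim it is known that a performatively stable point exists and is unique for each $t$.
   Formalization: The lower end of the stepsize interval is (1-r)/(α_t-β_tε_t) instead of (1-r)/(α_t+β_tε_t), for which λ̃≤r can fail (α=β=1, ε=r=1/2, η=1/3). D_t(x_t) is assumed to be supported in Z_t, so that f_t(x_t,D_t(x_t)) is defined. *)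

theory Defs
  imports "HOL-Probability.Probability"
begin

definition measure_support :: "'m::topological_space measure \<Rightarrow> 'm set" where
  "measure_support \<nu> = {z. \<forall>U. open U \<longrightarrow> z \<in> U \<longrightarrow> emeasure \<nu> U > 0}"

text \<open>Radon probability measures with finite first moment. For finite measures, being Radon
  amounts to inner regularity with respect to compact sets.\<close>

definition radon_prob1 :: "'m::metric_space measure set" where
  "radon_prob1 = {\<nu>. prob_space \<nu> \<and> sets \<nu> = sets borel \<and>
     (\<forall>B\<in>sets borel. emeasure \<nu> B = (SUP K\<in>{K. compact K \<and> K \<subseteq> B}. emeasure \<nu> K)) \<and>
     (\<exists>z0. integrable \<nu> (\<lambda>z. dist z0 z))}"

text \<open>On \<^const>\<open>radon_prob1\<close> the supremum ranges over a set of reals that is bounded above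
  and all the integrals exist.\<close>

definition wasserstein1 :: "'m::metric_space measure \<Rightarrow> 'm measure \<Rightarrow> real" where
  "wasserstein1 \<mu> \<nu> =
     (SUP g\<in>{g :: 'm \<Rightarrow> real. 1-lipschitz_on UNIV g}. integral\<^sup>L \<mu> g - integral\<^sup>L \<nu> g)"

text \<open>The loss at a fixed time is defined on a subset of \<open>M\<close> only; it is modelled by a total
  function whose values off that subset must play no role. An expectation is therefore
  integrated over the support, which has full measure because \<open>M\<close> is second countable.\<close>

definition expect :: "'m::topological_space measure \<Rightarrow> ('m \<Rightarrow> 'b) \<Rightarrow> 'b::{banach, second_countable_topology}"
  where "expect \<nu> g = (LINT z:measure_support \<nu>|\<nu>. g z)"

definition gradient :: "('a::real_inner \<Rightarrow> real) \<Rightarrow> 'a \<Rightarrow> 'a" where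
  "gradient f x = (THE v. GDERIV f x :> v)"

definition strongly_convex :: "real \<Rightarrow> ('a::real_inner \<Rightarrow> real) \<Rightarrow> bool" where
  "strongly_convex \<alpha> f \<longleftrightarrow>
     (\<forall>x y. \<forall>\<theta>\<in>{0..1}. f (\<theta> *\<^sub>R x + (1 - \<theta>) *\<^sub>R y)
        \<le> \<theta> * f x + (1 - \<theta>) * f y - \<alpha> / 2 * \<theta> * (1 - \<theta>) * (norm (x - y))\<^sup>2)"

text \<open>In the following definitions, all the data belong to one fixed time: \<open>D\<close> is the
  distributional map, \<open>C\<close> the constraint set and \<open>l\<close> the loss.\<close>

definition outcomes :: "('a \<Rightarrow> 'm::topological_space measure) \<Rightarrow> 'a set \<Rightarrow> 'm set" where
  "outcomes D C = (\<Union>x\<in>C. measure_support (D x))"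

definition expected_loss :: "('a \<Rightarrow> 'm::topological_space \<Rightarrow> real) \<Rightarrow> 'a \<Rightarrow> 'm measure \<Rightarrow> real" where
  "expected_loss l x \<nu> = expect \<nu> (l x)"

definition performatively_stable ::
  "('a \<Rightarrow> 'm::topological_space measure) \<Rightarrow> 'a set \<Rightarrow> ('a \<Rightarrow> 'm \<Rightarrow> real) \<Rightarrow> 'a \<Rightarrow> bool" where
  "performatively_stable D C l p \<longleftrightarrow>
     is_arg_min (\<lambda>x. expected_loss l x (D p)) (\<lambda>x. x \<in> C) p"

text \<open>The expected loss exists, is differentiable in the decision, and its gradient is the
  expected gradient of the loss. This is required only of those measures \<open>D y\<close> for which the
  expectation of a function defined on the outcomes makes sense; every \<open>y \<in> C\<close> qualifies.\<close>

definition interchangeable ::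
  "('a::euclidean_space \<Rightarrow> 'm::topological_space measure) \<Rightarrow> 'a set \<Rightarrow> ('a \<Rightarrow> 'm \<Rightarrow> real) \<Rightarrow> bool"
where
  "interchangeable D C l \<longleftrightarrow>
     (\<forall>x y. measure_support (D y) \<subseteq> outcomes D C \<longrightarrow>
        set_integrable (D y) (measure_support (D y)) (l x) \<and>
        GDERIV (\<lambda>u. expected_loss l u (D y)) x :> expect (D y) (\<lambda>z. gradient (\<lambda>u. l u z) x))"

text \<open>The lower end has \<open>\<alpha> - \<beta> * \<epsilon>\<close>: for \<open>\<beta> * \<epsilon> < \<alpha>\<close>, the inequality
  \<open>1 - \<eta> * \<alpha> + \<eta> * \<beta> * \<epsilon> \<le> r\<close> is equivalent to \<open>(1 - r) / (\<alpha> - \<beta> * \<epsilon>) \<le> \<eta>\<close>. With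
  \<open>\<alpha> + \<beta> * \<epsilon>\<close> in its place, the contraction factor can exceed \<open>r\<close>, for instance if
  \<open>\<alpha> = \<beta> = 1\<close>, \<open>\<epsilon> = r = 1/2\<close> and \<open>\<eta> = 1/3\<close>.\<close>

definition stepsize_range :: "real \<Rightarrow> real \<Rightarrow> real \<Rightarrow> real \<Rightarrow> real set" where
  "stepsize_range r \<alpha> \<beta> \<epsilon> = {(1 - r) / (\<alpha> - \<beta> * \<epsilon>) .. (1 + r) / (\<beta> * (1 + \<epsilon>))}"

end

theory Submission
  imports Defs
begin

text \<open>Write \<open>g y u\<close> for the gradient at \<open>u\<close> of the expected loss under \<open>D y\<close>. A stable point \<open>p\<close>
  minimizes over \<open>C\<close> the expected loss under \<open>D p\<close>, so it is fixed by the projected gradient step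
  that uses \<open>g p\<close>. Projections are nonexpansive, hence the distance from the next iterate to
  \<open>p\<close> is at most that between \<open>x - \<eta> *\<^sub>R g x x\<close> and \<open>p - \<eta> *\<^sub>R g p p\<close>; insert \<open>p - \<eta> *\<^sub>R g x p\<close>.
  The first part is a gradient step of a fixed strongly convex smooth function and contracts
  by \<open>\<rho>\<close>; the second is at most \<open>\<eta> * \<beta>\<close> times the Wasserstein distance of \<open>D x\<close> and \<open>D p\<close>, because
  \<open>inner v\<close> of the gradient of the loss is Lipschitz in the outcome. The drift of the stable
  points then enters as an additive perturbation.\<close>

section \<open>Gradient steps for strongly convex smooth functions\<close>

lemma GDERIV_imp_DERIV_along_line:
  assumes "GDERIV F (x + s *\<^sub>R v) :> g"
  shows "((\<lambda>s. F (x + s *\<^sub>R v)) has_real_derivative inner v g) (at s)"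
proof -
  have "((\<lambda>s. x + s *\<^sub>R v) has_derivative (\<lambda>h. h *\<^sub>R v)) (at s)"
    by (auto intro!: derivative_eq_intros)
  from has_derivative_compose[OF this assms[unfolded gderiv_def]]
  show ?thesis
    by (simp add: has_field_derivative_def mult.commute[of "inner v g" for v g] mult_commute_abs)
qed

text \<open>The limit is taken from the right because strong convexity and feasible directions both
  control the quotient only for \<open>s\<close> between 0 and 1.\<close>

lemma GDERIV_right_quotient_tendsto:
  assumes "GDERIV F x :> g"
  shows "((\<lambda>s. (F (x + s *\<^sub>R v) - F x) / s) \<longlongrightarrow> inner v g) (at_right 0)"
proof -
  have "((\<lambda>s. F (x + s *\<^sub>R v)) has_real_derivative inner v g) (at 0)"
    by (rule GDERIV_imp_DERIV_along_line) (simp add: assms)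
  then have "((\<lambda>s. (F (x + s *\<^sub>R v) - F x) / s) \<longlongrightarrow> inner v g) (at 0)"
    by (simp add: has_field_derivative_iff)
  then show ?thesis
    using filterlim_at_split by blast
qed

lemma GDERIV_unique:
  assumes "GDERIV F x :> g" "GDERIV F x :> h"
  shows "g = h"
proof -
  have "inner v g = inner v h" for v
    using tendsto_unique[OF _ GDERIV_right_quotient_tendsto[OF assms(1)]
        GDERIV_right_quotient_tendsto[OF assms(2)]] by simp
  then show ?thesis
    using vector_eq_ldot by blast
qed

lemma gradient_eqI: "GDERIV F x :> g \<Longrightarrow> gradient F x = g"
  unfolding gradient_def by (rule the_equality) (auto intro: GDERIV_unique)

text \<open>Strong convexity on the segment from \<open>x\<close> to \<open>w\<close>, divided by
  the parameter \<open>s\<close>, bounds a difference quotient; letting \<open>s\<close> tend to 0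
  gives the first-order form.\<close>

lemma strongly_convex_lower_bound:
  assumes F: "strongly_convex \<alpha> F" and g: "GDERIV F x :> g"
  shows "F x + inner (w - x) g + \<alpha> / 2 * (norm (w - x))\<^sup>2 \<le> F w"
proof -
  have "(F (x + s *\<^sub>R (w - x)) - F x) / s \<le> F w - F x - \<alpha> / 2 * (1 - s) * (norm (w - x))\<^sup>2"
    if s: "0 < s" "s < 1" for s :: real
  proof -
    have "F (s *\<^sub>R w + (1 - s) *\<^sub>R x)
        \<le> s * F w + (1 - s) * F x - \<alpha> / 2 * s * (1 - s) * (norm (w - x))\<^sup>2"
      using F s unfolding strongly_convex_def by simp
    also have "s *\<^sub>R w + (1 - s) *\<^sub>R x = x + s *\<^sub>R (w - x)"
      by (simp add: algebra_simps)
    finally have "F (x + s *\<^sub>R (w - x)) - F x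
        \<le> (F w - F x - \<alpha> / 2 * (1 - s) * (norm (w - x))\<^sup>2) * s"
      by (simp add: algebra_simps)
    then show ?thesis using s by (simp add: pos_divide_le_eq)
  qed
  then have ev: "\<forall>\<^sub>F s in at_right 0. (F (x + s *\<^sub>R (w - x)) - F x) / s
      \<le> F w - F x - \<alpha> / 2 * (1 - s) * (norm (w - x))\<^sup>2"
    unfolding eventually_at_right_field by (intro exI[of _ 1]) simp
  have "((\<lambda>s. F w - F x - \<alpha> / 2 * (1 - s) * (norm (w - x))\<^sup>2)
      \<longlongrightarrow> F w - F x - \<alpha> / 2 * (1 - 0) * (norm (w - x))\<^sup>2) (at_right 0)"
    by (intro tendsto_intros)
  from tendsto_le[OF _ this GDERIV_right_quotient_tendsto[OF g] ev] show ?thesis by simp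
qed

text \<open>The descent lemma without integration: \<open>p\<close> is what remains of
  \<open>F\<close> along the segment after subtracting the linear and quadratic terms.
  Cauchy--Schwarz and the Lipschitz bound make its derivative nonpositive.\<close>

lemma lipschitz_gradient_upper_bound:
  assumes G: "\<And>u. GDERIV F u :> G u" and L: "\<beta>-lipschitz_on UNIV G"
  shows "F w \<le> F x + inner (w - x) (G x) + \<beta> / 2 * (norm (w - x))\<^sup>2"
proof -
  define v where "v = w - x"
  define p where "p s = F (x + s *\<^sub>R v) - s * inner v (G x) - \<beta> / 2 * s\<^sup>2 * (norm v)\<^sup>2" for s
  have "p 1 \<le> p 0"
  proof (rule DERIV_nonpos_imp_nonincreasing[where f = p])
    fix s :: real assume s: "0 \<le> s" "s \<le> 1"
    have "(p has_real_derivative inner v (G (x + s *\<^sub>R v)) - inner v (G x) - \<beta> * s * (norm v)\<^sup>2) (at s)"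
      unfolding p_def
      by (rule derivative_eq_intros GDERIV_imp_DERIV_along_line[OF G] refl | simp)+
    moreover have "inner v (G (x + s *\<^sub>R v) - G x) \<le> norm v * norm (G (x + s *\<^sub>R v) - G x)"
      by (rule norm_cauchy_schwarz)
    moreover have "norm (G (x + s *\<^sub>R v) - G x) \<le> \<beta> * (s * norm v)"
      using lipschitz_onD[OF L, of "x + s *\<^sub>R v" x] s by (simp add: dist_norm)
    then have "norm v * norm (G (x + s *\<^sub>R v) - G x) \<le> norm v * (\<beta> * (s * norm v))"
      by (intro mult_left_mono) auto
    ultimately show "\<exists>y. (p has_real_derivative y) (at s) \<and> y \<le> 0"
      by (intro exI conjI) (auto simp: inner_diff_right power2_eq_square algebra_simps)
  qed simp
  then show ?thesis by (simp add: p_def v_def)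
qed

text \<open>This is the Baillon--Haddad inequality for \<open>F - \<alpha> / 2 * norm\<^sup>2\<close>, which is convex with
  \<open>(\<beta> - \<alpha>)\<close>-Lipschitz gradient: compare the bounds from \<open>x\<close> and from \<open>y\<close> at the endpoint of
  a gradient step of length \<open>1 / K\<close>. Letting \<open>K\<close> decrease to \<open>\<beta> - \<alpha>\<close> covers \<open>\<alpha> = \<beta>\<close>.\<close>

lemma gradient_cocoercive:
  fixes F :: "'a::real_inner \<Rightarrow> real"
  assumes lower: "\<And>x w. F x + inner (w - x) (G x) + \<alpha> / 2 * (norm (w - x))\<^sup>2 \<le> F w"
    and upper: "\<And>x w. F w \<le> F x + inner (w - x) (G x) + \<beta> / 2 * (norm (w - x))\<^sup>2"
  shows "0 \<le> inner (G x - G y - \<alpha> *\<^sub>R (x - y)) (\<beta> *\<^sub>R (x - y) - (G x - G y))"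
proof -
  define d where "d = G x - G y - \<alpha> *\<^sub>R (x - y)"
  have one: "F x + inner (y - x) (G x) + \<alpha> / 2 * (norm (x - y))\<^sup>2
      + (norm (G x - G y - \<alpha> *\<^sub>R (x - y)))\<^sup>2 / (2 * K) \<le> F y"
    if K: "0 < K" "\<beta> - \<alpha> \<le> K" for K x y
  proof -
    \<comment> \<open>Tilt \<open>F - \<alpha> / 2 * norm\<^sup>2\<close> linearly so that its
      gradient vanishes at \<open>x\<close>. Then \<open>- e\<close> is the gradient of the tilted
      function at \<open>y\<close>, and \<open>w\<close> is its gradient step from
      \<open>y\<close>.\<close>
    define e where "e = G x - G y - \<alpha> *\<^sub>R (x - y)"
    define w where "w = y + (1 / K) *\<^sub>R e"
    have a: "F x + inner (w - x) (G x) + \<alpha> / 2 * (norm (w - x))\<^sup>2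
       \<le> F y + inner (w - y) (G y) + \<beta> / 2 * (norm (w - y))\<^sup>2"
      using lower[of x w] upper[of w y] by linarith
    have "\<beta> / 2 * (norm (w - y))\<^sup>2 \<le> (\<alpha> + K) / 2 * (norm (w - y))\<^sup>2"
      by (intro mult_right_mono) (use K in auto)
    with a have b: "F x + inner (w - x) (G x) + \<alpha> / 2 * (norm (w - x))\<^sup>2
       \<le> F y + inner (w - y) (G y) + (\<alpha> + K) / 2 * (norm (w - y))\<^sup>2" by linarith
    have wx: "w - x = (y - x) + (1/K) *\<^sub>R e" and wy: "w - y = (1/K) *\<^sub>R e"
      by (auto simp: w_def)
    have n: "(norm (w - x))\<^sup>2 = (norm (x - y))\<^sup>2 - 2 / K * inner (x - y) e + (norm (w - y))\<^sup>2"
      unfolding wx wy power2_norm_eq_inner by (simp add: inner_simps inner_commute algebra_simps)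
    have i: "inner (w - x) (G x) = inner (y - x) (G x) + 1 / K * inner e (G x)"
      and j: "inner (w - y) (G y) = 1 / K * inner e (G y)"
      unfolding wx wy by (simp_all add: inner_add_left)
    have k: "K / 2 * (norm (w - y))\<^sup>2 = (norm e)\<^sup>2 / (2 * K)"
      using K unfolding wy norm_scaleR power_mult_distrib by (simp add: power2_eq_square)
    have l: "inner e (G x) - inner e (G y) - \<alpha> * inner (x - y) e = (norm e)\<^sup>2"
    proof -
      have "(norm e)\<^sup>2 = inner e (G x - G y - \<alpha> *\<^sub>R (x - y))"
        by (simp only: power2_norm_eq_inner e_def)
      then show ?thesis by (simp add: inner_simps inner_commute[of e])
    qed
    have "(norm e)\<^sup>2 / K = (inner e (G x) - inner e (G y) - \<alpha> * inner (x - y) e) / K"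
      by (simp add: l)
    then show ?thesis
      using b k unfolding n i j e_def[symmetric]
      by (simp add: algebra_simps add_divide_distrib diff_divide_distrib)
  qed
  have two: "(norm d)\<^sup>2 \<le> K * inner d (x - y)" if K: "0 < K" "\<beta> - \<alpha> \<le> K" for K
  proof -
    have e: "G y - G x - \<alpha> *\<^sub>R (y - x) = - d"
      by (simp add: d_def algebra_simps)
    \<comment> \<open>Adding the inequality to its mirror image with \<open>x\<close> and
      \<open>y\<close> exchanged cancels the values of \<open>F\<close>.\<close>
    have "inner (y - x) (G x) + inner (x - y) (G y) + \<alpha> * (norm (x - y))\<^sup>2 + (norm d)\<^sup>2 / K \<le> 0"
      using one[OF K, of x y] one[OF K, of y x]
      unfolding e d_def[symmetric] norm_minus_cancel norm_minus_commute[of y x] by simp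
    moreover have "inner (y - x) (G x) + inner (x - y) (G y) + \<alpha> * (norm (x - y))\<^sup>2 = - inner d (x - y)"
      by (simp add: d_def power2_norm_eq_inner inner_simps inner_commute algebra_simps)
    ultimately have "(norm d)\<^sup>2 / K \<le> inner d (x - y)" by linarith
    then show ?thesis using K by (simp add: pos_divide_le_eq mult.commute)
  qed
  have ab: "(\<beta> - \<alpha>) * (norm (x - y))\<^sup>2 \<ge> 0"
    using lower[of x y] upper[of y x] by (simp add: norm_minus_commute algebra_simps)
  have "(norm d)\<^sup>2 \<le> (\<beta> - \<alpha>) * inner d (x - y)"
  proof (cases "x = y")
    \<comment> \<open>Here \<open>ab\<close> does not determine the sign of
      \<open>\<beta> - \<alpha>\<close>, but both sides of the claim vanish.\<close>
    case True then show ?thesis using two[of "max 1 (\<beta> - \<alpha>)"] by simp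
  next
    case False
    then have "\<beta> - \<alpha> \<ge> 0" using ab by (simp add: zero_le_mult_iff)
    moreover have "((\<lambda>K. K * inner d (x - y)) \<longlongrightarrow> (\<beta> - \<alpha>) * inner d (x - y)) (at_right (\<beta> - \<alpha>))"
      by (intro tendsto_intros)
    moreover have "\<forall>\<^sub>F K in at_right (\<beta> - \<alpha>). (norm d)\<^sup>2 \<le> K * inner d (x - y)"
      unfolding eventually_at_right_field
      by (rule exI[of _ "\<beta> - \<alpha> + 1"]) (use two calculation(1) in auto)
    ultimately show ?thesis
      by (intro tendsto_lowerbound) auto
  qed
  then have "0 \<le> inner d ((\<beta> - \<alpha>) *\<^sub>R (x - y) - d)"
    by (simp only: inner_diff_right inner_scaleR_right power2_norm_eq_inner diff_ge_0_iff_ge)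
  also have "(\<beta> - \<alpha>) *\<^sub>R (x - y) - d = \<beta> *\<^sub>R (x - y) - (G x - G y)"
    by (simp add: d_def algebra_simps)
  finally show ?thesis
    by (simp only: d_def)
qed

text \<open>Center the gradient difference at \<open>((\<alpha> + \<beta>) / 2) *\<^sub>R d\<close>:
  by cocoercivity the remainder \<open>m\<close> has norm at most
  \<open>(\<beta> - \<alpha>) / 2 * norm d\<close>. This replaces eigenvalue bounds on a Hessian,
  which need not exist.\<close>

lemma gradient_step_lipschitz:
  fixes F :: "'a::real_inner \<Rightarrow> real"
  assumes lower: "\<And>x w. F x + inner (w - x) (G x) + \<alpha> / 2 * (norm (w - x))\<^sup>2 \<le> F w"
    and upper: "\<And>x w. F w \<le> F x + inner (w - x) (G x) + \<beta> / 2 * (norm (w - x))\<^sup>2"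
    and \<eta>: "0 \<le> \<eta>" and ab: "\<alpha> \<le> \<beta>"
  shows "norm ((x - \<eta> *\<^sub>R G x) - (y - \<eta> *\<^sub>R G y)) \<le> max \<bar>1 - \<eta> * \<alpha>\<bar> \<bar>1 - \<eta> * \<beta>\<bar> * norm (x - y)"
proof -
  define d where "d = x - y"
  define m where "m = G x - G y - ((\<alpha> + \<beta>) / 2) *\<^sub>R d"
  have "0 \<le> inner (m + ((\<beta> - \<alpha>) / 2) *\<^sub>R d) (((\<beta> - \<alpha>) / 2) *\<^sub>R d - m)"
  proof -
    have "G x - G y - \<alpha> *\<^sub>R (x - y) = m + ((\<beta> - \<alpha>) / 2) *\<^sub>R d"
      "\<beta> *\<^sub>R (x - y) - (G x - G y) = ((\<beta> - \<alpha>) / 2) *\<^sub>R d - m"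
      by (simp_all add: m_def d_def[symmetric] algebra_simps flip: scaleR_add_left)
        (simp_all add: field_simps flip: scaleR_add_left scaleR_diff_left)
    then show ?thesis using gradient_cocoercive[OF lower upper, of x y] by simp
  qed
  moreover have "inner (m + k *\<^sub>R d) (k *\<^sub>R d - m) = (k * norm d)\<^sup>2 - (norm m)\<^sup>2" for k
    unfolding power_mult_distrib power2_norm_eq_inner
    by (simp add: inner_add_left inner_diff_right inner_commute[of d m] power2_eq_square
        distrib_left)
  ultimately have "(norm m)\<^sup>2 \<le> ((\<beta> - \<alpha>) / 2 * norm d)\<^sup>2"
    by simp
  then have m: "norm m \<le> (\<beta> - \<alpha>) / 2 * norm d"
    by (rule power2_le_imp_le) (use ab in simp)
  have "(x - \<eta> *\<^sub>R G x) - (y - \<eta> *\<^sub>R G y) = (1 - \<eta> * ((\<alpha> + \<beta>) / 2)) *\<^sub>R d - \<eta> *\<^sub>R m"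
    by (simp add: m_def d_def algebra_simps)
  then have "norm ((x - \<eta> *\<^sub>R G x) - (y - \<eta> *\<^sub>R G y))
      \<le> \<bar>1 - \<eta> * ((\<alpha> + \<beta>) / 2)\<bar> * norm d + \<eta> * norm m"
    using norm_triangle_ineq4[of "(1 - \<eta> * ((\<alpha> + \<beta>) / 2)) *\<^sub>R d" "\<eta> *\<^sub>R m"] \<eta> by simp
  also have "\<dots> \<le> \<bar>1 - \<eta> * ((\<alpha> + \<beta>) / 2)\<bar> * norm d + \<eta> * ((\<beta> - \<alpha>) / 2 * norm d)"
    using m \<eta> by (intro add_left_mono mult_left_mono)
  also have "\<dots> = (\<bar>1 - \<eta> * ((\<alpha> + \<beta>) / 2)\<bar> + \<eta> * ((\<beta> - \<alpha>) / 2)) * norm d"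
    by (simp add: algebra_simps)
  also have "\<dots> \<le> max \<bar>1 - \<eta> * \<alpha>\<bar> \<bar>1 - \<eta> * \<beta>\<bar> * norm d"
  proof (rule mult_right_mono)
    have "\<eta> * \<alpha> \<le> \<eta> * \<beta>" using ab \<eta> by (rule mult_left_mono)
    moreover have "\<eta> * ((\<alpha> + \<beta>) / 2) = (\<eta> * \<alpha> + \<eta> * \<beta>) / 2"
      "\<eta> * ((\<beta> - \<alpha>) / 2) = (\<eta> * \<beta> - \<eta> * \<alpha>) / 2"
      by (simp_all add: distrib_left right_diff_distrib)
    \<comment> \<open>The two sides are in fact equal, so the triangle inequality above costs
      nothing in the final factor.\<close>
    moreover have "\<bar>1 - (p + q) / 2\<bar> + (q - p) / 2 \<le> max \<bar>1 - p\<bar> \<bar>1 - q\<bar>" if "p \<le> q" for p q :: real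
      using that by (simp add: abs_if max_def add_divide_distrib diff_divide_distrib)
    ultimately show "\<bar>1 - \<eta> * ((\<alpha> + \<beta>) / 2)\<bar> + \<eta> * ((\<beta> - \<alpha>) / 2) \<le> max \<bar>1 - \<eta> * \<alpha>\<bar> \<bar>1 - \<eta> * \<beta>\<bar>"
      by presburger
  qed simp
  finally show ?thesis by (simp add: d_def)
qed

text \<open>Minimality along segments into \<open>S\<close> gives
  \<open>0 \<le> inner (v - p) g\<close>. This is the obtuse-angle criterion for \<open>p\<close> to
  be the projection of \<open>p - \<eta> *\<^sub>R g\<close>.\<close>

lemma minimizer_is_closest_point:
  fixes p :: "'a::euclidean_space"
  assumes S: "convex S" "closed S" and p: "is_arg_min F (\<lambda>x. x \<in> S) p"
    and g: "GDERIV F p :> g" and \<eta>: "0 \<le> \<eta>"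
  shows "closest_point S (p - \<eta> *\<^sub>R g) = p"
proof -
  have pS: "p \<in> S" and min: "\<And>v. v \<in> S \<Longrightarrow> F p \<le> F v"
    using p by (auto simp: is_arg_min_linorder)
  have first_order: "0 \<le> inner (v - p) g" if v: "v \<in> S" for v
  proof (rule tendsto_lowerbound[OF GDERIV_right_quotient_tendsto[OF g]])
    have "p + s *\<^sub>R (v - p) \<in> S" if "0 < s" "s < 1" for s
      using convexD[OF S(1) pS v, of "1 - s" s] that by (simp add: algebra_simps)
    then show "\<forall>\<^sub>F s in at_right 0. 0 \<le> (F (p + s *\<^sub>R (v - p)) - F p) / s"
      unfolding eventually_at_right_field by (intro exI[of _ 1]) (auto simp: min)
  qed simp
  have "dist (p - \<eta> *\<^sub>R g) p \<le> dist (p - \<eta> *\<^sub>R g) v" if v: "v \<in> S" for v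
  proof -
    have "(norm (\<eta> *\<^sub>R g))\<^sup>2 \<le> (norm (\<eta> *\<^sub>R g + (v - p)))\<^sup>2"
      using mult_nonneg_nonneg[OF \<eta> first_order[OF v]]
      unfolding power2_norm_eq_inner by (simp add: inner_add_left inner_add_right inner_commute)
    then have "norm (\<eta> *\<^sub>R g) \<le> norm (\<eta> *\<^sub>R g + (v - p))"
      by (rule power2_le_imp_le) simp
    moreover have "norm (p - \<eta> *\<^sub>R g - v) = norm (\<eta> *\<^sub>R g + (v - p))"
      by (rule trans[OF norm_minus_cancel[symmetric]]) (simp add: algebra_simps)
    ultimately show ?thesis by (simp add: dist_norm)
  qed
  then show ?thesis
    using closest_point_unique[OF S pS] by metis
qed

section \<open>Expectations and the Wasserstein distance\<close>

lemma closed_measure_support: "closed (measure_support \<nu>)"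
proof -
  have "- measure_support \<nu> = \<Union>{U. open U \<and> emeasure \<nu> U = 0}"
    by (auto simp: measure_support_def zero_less_iff_neq_zero)
  moreover have "open (\<Union>{U. open U \<and> emeasure \<nu> U = 0})"
    by (rule open_Union) auto
  ultimately show ?thesis
    by (simp add: closed_def)
qed

text \<open>Each point off the support lies in a null member of a countable basis, so countably many
  null sets cover the complement.\<close>

lemma AE_measure_support:
  fixes \<nu> :: "'m::second_countable_topology measure"
  assumes "sets \<nu> = sets borel"
  shows "AE z in \<nu>. z \<in> measure_support \<nu>"
proof -
  obtain B :: "'m set set" where B: "countable B" "topological_basis B"
    using ex_countable_basis by blast
  define N where "N = {U \<in> B. emeasure \<nu> U = 0}"
  have "\<Union>N \<in> null_sets \<nu>"
  proof (rule null_sets_UN'[of N "\<lambda>U. U", simplified])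
    show "countable N" using B(1) by (auto simp: N_def)
    fix U assume "U \<in> N"
    moreover from this have "open U" using topological_basis_open[OF B(2)] by (simp add: N_def)
    ultimately show "U \<in> null_sets \<nu>" by (auto simp: null_sets_def assms N_def)
  qed
  moreover have "z \<in> \<Union>N" if z: "z \<notin> measure_support \<nu>" for z
  proof -
    obtain U where U: "open U" "z \<in> U" "emeasure \<nu> U = 0"
      using z by (auto simp: measure_support_def zero_less_iff_neq_zero)
    obtain V where V: "V \<in> B" "z \<in> V" "V \<subseteq> U"
      using topological_basisE[OF B(2) U(1,2)] .
    have "emeasure \<nu> V \<le> emeasure \<nu> U"
      using U(1) V(3) by (intro emeasure_mono) (auto simp: assms)
    then show ?thesis using U(3) V by (auto simp: N_def)
  qed
  ultimately show ?thesis
    by (intro AE_I'[of "\<Union>N"]) auto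
qed

text \<open>McShane's extension: the largest \<open>L\<close>-Lipschitz function with the given values on \<open>S\<close>.\<close>

lemma lipschitz_on_extend_UNIV:
  fixes g :: "'m::metric_space \<Rightarrow> real"
  assumes g: "L-lipschitz_on S g"
  obtains h where "L-lipschitz_on UNIV h" "\<And>x. x \<in> S \<Longrightarrow> h x = g x"
proof (cases "S = {}")
  \<comment> \<open>A real infimum over the empty set would be unspecified; any constant
    serves.\<close>
  case True
  then show ?thesis
    using that[of "\<lambda>_. 0"] lipschitz_on_nonneg[OF g] by (simp add: lipschitz_on_def)
next
  case False
  then obtain a where a: "a \<in> S" by blast
  have L: "0 \<le> L" by (rule lipschitz_on_nonneg[OF g])
  have gS: "g s \<le> g s' + L * dist s s'" if "s \<in> S" "s' \<in> S" for s s'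
    using lipschitz_onD[OF g that] by (simp add: dist_real_def)
  have triangle: "L * dist s u \<le> L * dist s v + L * dist v u" for s u v
    using mult_left_mono[OF dist_triangle[of s u v] L] by (simp add: distrib_left)
  define h where "h x = (INF s\<in>S. g s + L * dist x s)" for x
  \<comment> \<open>The real infimum is meaningful only with a lower bound; the value at the anchor
    \<open>a\<close> supplies one.\<close>
  have bdd: "bdd_below ((\<lambda>s. g s + L * dist x s) ` S)" for x
  proof (rule bdd_belowI2)
    fix s assume s: "s \<in> S"
    show "g a - L * dist x a \<le> g s + L * dist x s"
      using gS[OF a s] triangle[of a s x] by (simp add: dist_commute)
  qed
  have "h x \<le> h y + L * dist x y" for x y
  proof -
    have "h x - L * dist x y \<le> g s + L * dist y s" if s: "s \<in> S" for s
      using cINF_lower[OF bdd s, of x] triangle[of x s y] unfolding h_def by linarith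
    then have "h x - L * dist x y \<le> h y"
      unfolding h_def[of y] by (rule cINF_greatest[OF False])
    then show ?thesis by linarith
  qed
  then have "dist (h x) (h y) \<le> L * dist x y" for x y
    unfolding dist_real_def by (smt (verit) dist_commute)
  moreover have "h x = g x" if x: "x \<in> S" for x
  proof (rule antisym)
    show "h x \<le> g x" using cINF_lower[OF bdd x, of x] by (simp add: h_def)
    show "g x \<le> h x" unfolding h_def using gS[OF x] by (intro cINF_greatest False)
  qed
  ultimately show ?thesis
    using that[of h] L by (auto simp: lipschitz_on_def)
qed

text \<open>The definition provides a first moment about some point; the triangle inequality moves
  the center to an arbitrary \<open>a\<close>.\<close>

lemma radon_prob1D:
  assumes "\<nu> \<in> radon_prob1"
  shows "prob_space \<nu>" "sets \<nu> = sets borel" "integrable \<nu> (\<lambda>z. dist a z)"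
proof -
  show p: "prob_space \<nu>" and s: "sets \<nu> = sets borel"
    using assms by (auto simp: radon_prob1_def)
  obtain z0 where z0: "integrable \<nu> (\<lambda>z. dist z0 z)"
    using assms by (auto simp: radon_prob1_def)
  interpret prob_space \<nu> by (rule p)
  show "integrable \<nu> (\<lambda>z. dist a z)"
  proof (rule Bochner_Integration.integrable_bound)
    show "integrable \<nu> (\<lambda>z. dist a z0 + dist z0 z)"
      using z0 by simp
    have "(\<lambda>z. dist a z) \<in> borel_measurable borel"
      by (intro borel_measurable_continuous_onI continuous_intros)
    then show "(\<lambda>z. dist a z) \<in> borel_measurable \<nu>"
      using measurable_cong_sets[OF s refl] by blast
    show "AE z in \<nu>. norm (dist a z) \<le> norm (dist a z0 + dist z0 z)"
      by (simp add: dist_triangle)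
  qed
qed

text \<open>On \<open>A\<close> the growth of \<open>g\<close> is at most linear in the distance
  from a fixed point, so the first moment dominates it. Measurability concerns only \<open>g\<close>
  cut off outside \<open>A\<close>, where it is continuous.\<close>

lemma set_integrable_lipschitz:
  fixes g :: "'m::metric_space \<Rightarrow> 'b::{banach, second_countable_topology}"
  assumes \<nu>: "\<nu> \<in> radon_prob1" and A: "A \<in> sets borel" and g: "L-lipschitz_on A g"
  shows "set_integrable \<nu> A g"
proof (cases "A = {}")
  case True
  then show ?thesis by (simp add: set_integrable_def)
next
  case False
  then obtain a where a: "a \<in> A" by blast
  interpret prob_space \<nu> by (rule radon_prob1D[OF \<nu>])
  show ?thesis unfolding set_integrable_def
  proof (rule Bochner_Integration.integrable_bound)
    show "integrable \<nu> (\<lambda>z. norm (g a) + L * dist a z)"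
      using radon_prob1D(3)[OF \<nu>] by simp
    have "(\<lambda>z. indicator A z *\<^sub>R g z) \<in> borel_measurable borel"
      by (rule borel_measurable_continuous_on_indicator[OF A lipschitz_on_continuous_on[OF g]])
    then show "(\<lambda>z. indicator A z *\<^sub>R g z) \<in> borel_measurable \<nu>"
      using measurable_cong_sets[OF radon_prob1D(2)[OF \<nu>] refl] by blast
    have "norm (g z) \<le> norm (g a) + L * dist a z" if z: "z \<in> A" for z
      using lipschitz_onD[OF g z a] norm_triangle_sub[of "g z" "g a"]
      by (simp add: dist_norm dist_commute[of z a])
    moreover have "0 \<le> L" by (rule lipschitz_on_nonneg[OF g])
    ultimately have "norm (indicator A z *\<^sub>R g z) \<le> norm (norm (g a) + L * dist a z)" for z
      by (auto simp: indicator_def)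
    then show "AE z in \<nu>. norm (indicator A z *\<^sub>R g z) \<le> norm (norm (g a) + L * dist a z)"
      by simp
  qed
qed

lemma integrable_lipschitz:
  fixes g :: "'m::metric_space \<Rightarrow> 'b::{banach, second_countable_topology}"
  assumes "\<nu> \<in> radon_prob1" and "L-lipschitz_on UNIV g"
  shows "integrable \<nu> g"
  using set_integrable_lipschitz[OF assms(1) _ assms(2)] by (simp add: set_integrable_def)

text \<open>Rescaling by \<open>L\<close> reduces to the functions over which the supremum is
  taken.\<close>

lemma lipschitz_integral_diff_le_wasserstein1:
  fixes \<mu> \<nu> :: "'m::metric_space measure"
  assumes \<mu>: "\<mu> \<in> radon_prob1" and \<nu>: "\<nu> \<in> radon_prob1" and g: "L-lipschitz_on UNIV g"
  shows "integral\<^sup>L \<mu> g - integral\<^sup>L \<nu> g \<le> L * wasserstein1 \<mu> \<nu>"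
proof -
  interpret \<mu>: prob_space \<mu> by (rule radon_prob1D[OF \<mu>])
  interpret \<nu>: prob_space \<nu> by (rule radon_prob1D[OF \<nu>])
  fix a :: 'm
  \<comment> \<open>A real supremum bounds its members only if the set is bounded above; the first
    moments about \<open>a\<close> give a bound uniform in \<open>g\<close>.\<close>
  have "bdd_above ((\<lambda>g. integral\<^sup>L \<mu> g - integral\<^sup>L \<nu> g) ` {g :: 'm \<Rightarrow> real. 1-lipschitz_on UNIV g})"
  proof (rule bdd_aboveI2)
    fix g :: "'m \<Rightarrow> real" assume "g \<in> {g. 1-lipschitz_on UNIV g}"
    then have g: "1-lipschitz_on UNIV g" by simp
    have ga: "\<bar>g z - g a\<bar> \<le> dist a z" for z
      using lipschitz_onD[OF g, of z a] by (simp add: dist_real_def dist_commute)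
    have "integral\<^sup>L \<mu> g \<le> integral\<^sup>L \<mu> (\<lambda>z. g a + dist a z)"
      using ga by (intro integral_mono integrable_lipschitz[OF \<mu> g])
        (auto simp: radon_prob1D(3)[OF \<mu>] abs_le_iff algebra_simps)
    moreover have "integral\<^sup>L \<nu> (\<lambda>z. g a - dist a z) \<le> integral\<^sup>L \<nu> g"
      using ga by (intro integral_mono integrable_lipschitz[OF \<nu> g])
        (auto simp: radon_prob1D(3)[OF \<nu>] abs_le_iff algebra_simps)
    ultimately show "integral\<^sup>L \<mu> g - integral\<^sup>L \<nu> g
        \<le> integral\<^sup>L \<mu> (\<lambda>z. dist a z) + integral\<^sup>L \<nu> (\<lambda>z. dist a z)"
      by (simp add: radon_prob1D(3)[OF \<mu>] radon_prob1D(3)[OF \<nu>] \<mu>.prob_space \<nu>.prob_space)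
  qed
  from cSUP_upper[OF _ this] have unit:
    "integral\<^sup>L \<mu> g - integral\<^sup>L \<nu> g \<le> wasserstein1 \<mu> \<nu>" if "1-lipschitz_on UNIV g" for g :: "'m \<Rightarrow> real"
    using that unfolding wasserstein1_def by blast
  show ?thesis
  proof (cases "L = 0")
    \<comment> \<open>Rescaling is impossible here, but \<open>g\<close> is constant and the two
      integrals agree.\<close>
    case True
    then have "g z = g a" for z
      using lipschitz_onD[OF g, of z a] by simp
    then have "g = (\<lambda>_. g a)" by blast
    moreover have "integral\<^sup>L \<mu> (\<lambda>_. g a) = g a" "integral\<^sup>L \<nu> (\<lambda>_. g a) = g a"
      by (simp_all add: \<mu>.prob_space \<nu>.prob_space)
    ultimately have "integral\<^sup>L \<mu> g = g a" "integral\<^sup>L \<nu> g = g a"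
      by metis+
    then show ?thesis using True by simp
  next
    case False
    then have L: "0 < L" using lipschitz_on_nonneg[OF g] by simp
    have "1-lipschitz_on UNIV (\<lambda>z. g z / L)"
      using lipschitz_onD[OF g] L
      by (auto simp: lipschitz_on_def dist_real_def pos_divide_le_eq mult.commute
          simp flip: diff_divide_distrib)
    from unit[OF this] show ?thesis
      using L by (simp add: pos_divide_le_eq mult.commute flip: diff_divide_distrib)
  qed
qed

text \<open>Test the vector difference \<open>v\<close> against itself to get a scalar function. It
  is Lipschitz only on \<open>S\<close>, while the Wasserstein supremum uses functions on the whole
  space, so it is extended to \<open>h\<close>; the integrals do not change because the supports lie
  in \<open>S\<close> and have full measure. Finally cancel \<open>norm v\<close>.\<close>

lemma norm_expect_diff_le_wasserstein1:
  fixes G :: "'m::{metric_space, second_countable_topology} \<Rightarrow> 'b::euclidean_space"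
  assumes \<mu>: "\<mu> \<in> radon_prob1" "measure_support \<mu> \<subseteq> S"
    and \<nu>: "\<nu> \<in> radon_prob1" "measure_support \<nu> \<subseteq> S"
    and G: "\<beta>-lipschitz_on S G"
  shows "norm (expect \<mu> G - expect \<nu> G) \<le> \<beta> * wasserstein1 \<mu> \<nu>"
proof -
  define v where "v = expect \<mu> G - expect \<nu> G"
  have "(norm v * \<beta>)-lipschitz_on S (\<lambda>z. inner v (G z))"
  proof (rule lipschitz_onI)
    fix x y assume xy: "x \<in> S" "y \<in> S"
    have "dist (inner v (G x)) (inner v (G y)) \<le> norm v * norm (G x - G y)"
      unfolding dist_real_def inner_diff_right[symmetric] by (rule Cauchy_Schwarz_ineq2)
    also have "\<dots> \<le> norm v * (\<beta> * dist x y)"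
      using lipschitz_onD[OF G xy] by (intro mult_left_mono) (simp_all add: dist_norm)
    finally show "dist (inner v (G x)) (inner v (G y)) \<le> norm v * \<beta> * dist x y"
      by (simp add: mult.assoc)
  qed (use lipschitz_on_nonneg[OF G] in simp)
  then obtain h where h: "(norm v * \<beta>)-lipschitz_on UNIV h"
    and hS: "\<And>z. z \<in> S \<Longrightarrow> h z = inner v (G z)"
    using lipschitz_on_extend_UNIV by blast
  have expect_inner: "inner v (expect \<kappa> G) = integral\<^sup>L \<kappa> h"
    if \<kappa>: "\<kappa> \<in> radon_prob1" "measure_support \<kappa> \<subseteq> S" for \<kappa>
  proof -
    have "set_integrable \<kappa> (measure_support \<kappa>) G"
      by (rule set_integrable_lipschitz[OF \<kappa>(1) _ lipschitz_on_subset[OF G \<kappa>(2)]])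
        (simp add: closed_measure_support)
    then have int: "integrable \<kappa> (\<lambda>z. indicator (measure_support \<kappa>) z *\<^sub>R G z)"
      by (simp add: set_integrable_def)
    have "inner v (expect \<kappa> G) = (LINT z|\<kappa>. inner v (indicator (measure_support \<kappa>) z *\<^sub>R G z))"
      unfolding expect_def set_lebesgue_integral_def
      by (rule integral_inner_right[symmetric]) (rule int)
    also have "\<dots> = integral\<^sup>L \<kappa> h"
    proof (rule integral_cong_AE)
      show "AE z in \<kappa>. inner v (indicator (measure_support \<kappa>) z *\<^sub>R G z) = h z"
        using AE_measure_support[OF radon_prob1D(2)[OF \<kappa>(1)]]
        by eventually_elim (use hS \<kappa>(2) in auto)
      show "h \<in> borel_measurable \<kappa>"
        using integrable_lipschitz[OF \<kappa>(1) h] by simp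
      show "(\<lambda>z. inner v (indicator (measure_support \<kappa>) z *\<^sub>R G z)) \<in> borel_measurable \<kappa>"
        using int by (intro borel_measurable_inner borel_measurable_const) simp
    qed
    finally show ?thesis .
  qed
  have "norm v * norm v = inner v v"
    by (simp add: power2_norm_eq_inner flip: power2_eq_square)
  also have "\<dots> = integral\<^sup>L \<mu> h - integral\<^sup>L \<nu> h"
    by (simp add: expect_inner[OF \<mu>, symmetric] expect_inner[OF \<nu>, symmetric]
        flip: inner_diff_right v_def)
  also have "\<dots> \<le> norm v * (\<beta> * wasserstein1 \<mu> \<nu>)"
    using lipschitz_integral_diff_le_wasserstein1[OF \<mu>(1) \<nu>(1) h] by (simp add: mult.assoc)
  finally show ?thesis
  proof (cases "v = 0")
    case True
    \<comment> \<open>With \<open>norm v = 0\<close> nothing can be cancelled; the zero test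
      function shows that the right side is nonnegative.\<close>
    have "0 \<le> \<beta> * wasserstein1 \<mu> \<nu>"
      using lipschitz_integral_diff_le_wasserstein1[OF \<mu>(1) \<nu>(1), of \<beta> "\<lambda>_. 0"]
        lipschitz_on_nonneg[OF G] by (simp add: lipschitz_on_def)
    then show ?thesis using True by (simp add: v_def)
  qed (simp add: v_def)
qed

lemma prob_measure_support:
  fixes \<nu> :: "'m::{metric_space, second_countable_topology} measure"
  assumes "\<nu> \<in> radon_prob1"
  shows "measure \<nu> (measure_support \<nu>) = 1"
proof -
  interpret prob_space \<nu> by (rule radon_prob1D[OF assms])
  show ?thesis
    using AE_measure_support[OF radon_prob1D(2)[OF assms]]
    by (subst prob_eq_1) (simp_all add: radon_prob1D(2)[OF assms] closed_measure_support)
qed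

lemma norm_expect_le:
  fixes H :: "'m::{metric_space, second_countable_topology} \<Rightarrow> 'b::euclidean_space"
  assumes \<nu>: "\<nu> \<in> radon_prob1" and H: "set_integrable \<nu> (measure_support \<nu>) H"
    and c: "\<And>z. z \<in> measure_support \<nu> \<Longrightarrow> norm (H z) \<le> c" "0 \<le> c"
  shows "norm (expect \<nu> H) \<le> c"
proof -
  interpret prob_space \<nu> by (rule radon_prob1D[OF \<nu>])
  have "norm (expect \<nu> H) \<le> (LINT z|\<nu>. norm (indicator (measure_support \<nu>) z *\<^sub>R H z))"
    unfolding expect_def set_lebesgue_integral_def by (rule integral_norm_bound)
  also have "\<dots> \<le> (LINT z|\<nu>. c)"
    using H c by (intro integral_mono integrable_norm) (auto simp: set_integrable_def indicator_def)
  finally show ?thesis by (simp add: prob_space)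
qed

lemma strongly_convex_expected_loss:
  fixes l :: "'a::real_inner \<Rightarrow> 'm::{metric_space, second_countable_topology} \<Rightarrow> real"
  assumes \<nu>: "\<nu> \<in> radon_prob1"
    and int: "\<And>u. set_integrable \<nu> (measure_support \<nu>) (l u)"
    and l: "\<And>z. z \<in> measure_support \<nu> \<Longrightarrow> strongly_convex \<alpha> (\<lambda>u. l u z)"
  shows "strongly_convex \<alpha> (\<lambda>u. expected_loss l u \<nu>)"
  unfolding strongly_convex_def
proof (intro allI ballI)
  fix x y :: 'a and \<theta> :: real assume \<theta>: "\<theta> \<in> {0..1}"
  interpret prob_space \<nu> by (rule radon_prob1D[OF \<nu>])
  let ?S = "measure_support \<nu>"
  \<comment> \<open>The quadratic term is constant in the outcome, and integrates to itself because
    the support has mass 1.\<close>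
  define k where "k = \<alpha> / 2 * \<theta> * (1 - \<theta>) * (norm (x - y))\<^sup>2"
  have "set_integrable \<nu> ?S (\<lambda>_. k)"
    by (rule set_integrable_lipschitz[OF \<nu>, of _ 0])
      (simp_all add: closed_measure_support lipschitz_on_constant)
  note ints = this set_integrable_mult_right[OF int] set_integral_add(1) set_integral_diff(1)
  have "expected_loss l (\<theta> *\<^sub>R x + (1 - \<theta>) *\<^sub>R y) \<nu>
      \<le> (LINT z:?S|\<nu>. \<theta> * l x z + (1 - \<theta>) * l y z - k)"
    unfolding expected_loss_def expect_def
  proof (rule set_integral_mono)
    show "set_integrable \<nu> ?S (\<lambda>z. \<theta> * l x z + (1 - \<theta>) * l y z - k)"
      by (intro ints)
  qed (use int l \<theta> in \<open>auto simp: strongly_convex_def k_def\<close>)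
  also have "\<dots> = \<theta> * expected_loss l x \<nu> + (1 - \<theta>) * expected_loss l y \<nu> - (LINT z:?S|\<nu>. k)"
    unfolding expected_loss_def expect_def
    by (subst set_integral_diff(2), intro ints, intro ints, subst set_integral_add(2))
      (intro ints, intro ints, simp)
  also have "(LINT z:?S|\<nu>. k) = k"
    using prob_measure_support[OF \<nu>]
    by (simp add: set_lebesgue_integral_def sets_eq_imp_space_eq[OF radon_prob1D(2)[OF \<nu>]])
  finally show "expected_loss l (\<theta> *\<^sub>R x + (1 - \<theta>) *\<^sub>R y) \<nu>
      \<le> \<theta> * expected_loss l x \<nu> + (1 - \<theta>) * expected_loss l y \<nu> - \<alpha> / 2 * \<theta> * (1 - \<theta>) * (norm (x - y))\<^sup>2"
    by (simp only: k_def)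
qed

section \<open>Projected gradient steps and stable points\<close>

text \<open>The data of a single time, so that the time index enters only in the final
  recursion.\<close>

locale performative_problem =
  fixes D :: "'a::euclidean_space \<Rightarrow> 'm::{metric_space, second_countable_topology} measure"
    and C :: "'a set" and l :: "'a \<Rightarrow> 'm \<Rightarrow> real" and \<alpha> \<beta> :: real
  assumes radon: "D u \<in> radon_prob1"
    and interchange: "interchangeable D C l"
    and loss_strongly_convex: "z \<in> outcomes D C \<Longrightarrow> strongly_convex \<alpha> (\<lambda>u. l u z)"
    and gradient_lipschitz_decision:
      "z \<in> outcomes D C \<Longrightarrow> \<beta>-lipschitz_on UNIV (\<lambda>u. gradient (\<lambda>v. l v z) u)"
    and gradient_lipschitz_outcome:
      "\<beta>-lipschitz_on (outcomes D C) (\<lambda>z. gradient (\<lambda>v. l v z) u)"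
begin

text \<open>The decision that fixes the distribution and the point of differentiation are separate
  arguments, since the step estimate changes them one at a time.\<close>

definition expected_gradient :: "'a \<Rightarrow> 'a \<Rightarrow> 'a" where
  "expected_gradient y u = expect (D y) (\<lambda>z. gradient (\<lambda>v. l v z) u)"

lemma beta_nonneg: "0 \<le> \<beta>"
  by (rule lipschitz_on_nonneg[OF gradient_lipschitz_outcome])

lemma GDERIV_expected_loss:
  assumes "measure_support (D y) \<subseteq> outcomes D C"
  shows "GDERIV (\<lambda>u. expected_loss l u (D y)) u :> expected_gradient y u"
  using interchange assms unfolding interchangeable_def expected_gradient_def by blast

lemma expected_gradient_lipschitz:
  assumes y: "measure_support (D y) \<subseteq> outcomes D C"
  shows "\<beta>-lipschitz_on UNIV (expected_gradient y)"
proof (rule lipschitz_onI)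
  fix u w
  let ?S = "measure_support (D y)" and ?g = "\<lambda>u z. gradient (\<lambda>v. l v z) u"
  \<comment> \<open>Smoothness in the outcome yields integrability; smoothness in the decision
    yields the bound further below.\<close>
  have int: "set_integrable (D y) ?S (?g u)" for u
    by (rule set_integrable_lipschitz[OF radon _ lipschitz_on_subset[OF gradient_lipschitz_outcome y]])
      (simp add: closed_measure_support)
  have "expected_gradient y u - expected_gradient y w = expect (D y) (\<lambda>z. ?g u z - ?g w z)"
    unfolding expected_gradient_def expect_def using int by (simp add: set_integral_diff(2))
  also have "norm \<dots> \<le> \<beta> * dist u w"
  proof (rule norm_expect_le[OF radon set_integral_diff(1)[OF int int]])
    fix z assume "z \<in> ?S"
    then show "norm (?g u z - ?g w z) \<le> \<beta> * dist u w"
      using lipschitz_onD[OF gradient_lipschitz_decision, of z u w] y by (auto simp: dist_norm)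
  qed (simp add: beta_nonneg)
  finally show "dist (expected_gradient y u) (expected_gradient y w) \<le> \<beta> * dist u w"
    by (simp add: dist_norm)
qed (rule beta_nonneg)

lemma expected_loss_lower_bound:
  assumes y: "measure_support (D y) \<subseteq> outcomes D C"
  shows "expected_loss l x (D y) + inner (w - x) (expected_gradient y x) + \<alpha> / 2 * (norm (w - x))\<^sup>2
    \<le> expected_loss l w (D y)"
proof (rule strongly_convex_lower_bound[OF strongly_convex_expected_loss GDERIV_expected_loss])
  show "set_integrable (D y) (measure_support (D y)) (l u)" for u
    using interchange y unfolding interchangeable_def by blast
qed (use radon y loss_strongly_convex in auto)

lemmas expected_loss_upper_bound =
  lipschitz_gradient_upper_bound[OF GDERIV_expected_loss expected_gradient_lipschitz]

lemma measure_support_subset_outcomes: "y \<in> C \<Longrightarrow> measure_support (D y) \<subseteq> outcomes D C"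
  by (auto simp: outcomes_def)

text \<open>The lower and upper quadratic bounds, expanded at 0 and evaluated at a unit vector,
  differ only in curvature. A point of \<open>C\<close> provides a distribution supported on
  outcomes.\<close>

lemma alpha_le_beta:
  assumes "C \<noteq> {}"
  shows "\<alpha> \<le> \<beta>"
proof -
  obtain y where "y \<in> C" using assms by blast
  then have y: "measure_support (D y) \<subseteq> outcomes D C"
    by (rule measure_support_subset_outcomes)
  obtain b :: 'a where b: "b \<in> Basis" using nonempty_Basis by blast
  show ?thesis
    using expected_loss_lower_bound[OF y, of 0 b] expected_loss_upper_bound[OF y y, of b 0] b
    by simp
qed

lemma projected_gradient_step:
  assumes C: "closed C" "convex C" and \<eta>: "0 \<le> \<eta>"
    and sensitivity: "\<And>u u'. wasserstein1 (D u) (D u') \<le> \<epsilon> * norm (u - u')"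
    and x: "measure_support (D x) \<subseteq> outcomes D C"
    and p: "performatively_stable D C l p"
  shows "norm (closest_point C (x - \<eta> *\<^sub>R gradient (\<lambda>u. expected_loss l u (D x)) x) - p)
    \<le> (max \<bar>1 - \<eta> * \<alpha>\<bar> \<bar>1 - \<eta> * \<beta>\<bar> + \<eta> * \<beta> * \<epsilon>) * norm (x - p)"
proof -
  let ?g = "expected_gradient"
  have pC: "p \<in> C"
    using p by (simp add: performatively_stable_def is_arg_min_def)
  have ps: "measure_support (D p) \<subseteq> outcomes D C"
    by (rule measure_support_subset_outcomes[OF pC])
  have "closest_point C (p - \<eta> *\<^sub>R ?g p p) = p"
    using minimizer_is_closest_point[OF C(2,1) _ GDERIV_expected_loss[OF ps] \<eta>] p
    by (simp add: performatively_stable_def)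
  then have "norm (closest_point C (x - \<eta> *\<^sub>R ?g x x) - p)
      = dist (closest_point C (x - \<eta> *\<^sub>R ?g x x)) (closest_point C (p - \<eta> *\<^sub>R ?g p p))"
    by (simp add: dist_norm)
  also have "\<dots> \<le> dist (x - \<eta> *\<^sub>R ?g x x) (p - \<eta> *\<^sub>R ?g p p)"
    using C pC by (intro closest_point_lipschitz) auto
  also have "\<dots> \<le> dist (x - \<eta> *\<^sub>R ?g x x) (p - \<eta> *\<^sub>R ?g x p)
      + dist (p - \<eta> *\<^sub>R ?g x p) (p - \<eta> *\<^sub>R ?g p p)"
    by (rule dist_triangle)
  also have "dist (x - \<eta> *\<^sub>R ?g x x) (p - \<eta> *\<^sub>R ?g x p)
      \<le> max \<bar>1 - \<eta> * \<alpha>\<bar> \<bar>1 - \<eta> * \<beta>\<bar> * norm (x - p)"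
    unfolding dist_norm
    using gradient_step_lipschitz[OF expected_loss_lower_bound[OF x]
        expected_loss_upper_bound[OF x x] \<eta> alpha_le_beta] pC by auto
  also have "dist (p - \<eta> *\<^sub>R ?g x p) (p - \<eta> *\<^sub>R ?g p p) = \<eta> * norm (?g x p - ?g p p)"
    using \<eta> by (simp add: dist_norm norm_minus_commute flip: scaleR_diff_right)
  also have "\<eta> * norm (?g x p - ?g p p) \<le> \<eta> * (\<beta> * (\<epsilon> * norm (x - p)))"
  proof (rule mult_left_mono[OF _ \<eta>])
    have "norm (?g x p - ?g p p) \<le> \<beta> * wasserstein1 (D x) (D p)"
      unfolding expected_gradient_def
      by (rule norm_expect_diff_le_wasserstein1[OF radon x radon ps gradient_lipschitz_outcome])
    also have "\<dots> \<le> \<beta> * (\<epsilon> * norm (x - p))"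
      by (rule mult_left_mono[OF sensitivity beta_nonneg])
    finally show "norm (?g x p - ?g p p) \<le> \<beta> * (\<epsilon> * norm (x - p))" .
  qed
  \<comment> \<open>The iteration uses \<open>gradient\<close>, a definite description;
    differentiability identifies it with \<open>expected_gradient x x\<close>.\<close>
  finally show ?thesis
    by (simp add: gradient_eqI[OF GDERIV_expected_loss[OF x]] algebra_simps)
qed

end

section \<open>Scalar recursions and the step size condition\<close>

lemma perturbed_recursion_bound:
  fixes c e \<phi> :: "nat \<Rightarrow> real"
  assumes c: "\<And>t. 0 \<le> c t" and step: "\<And>t. e (Suc t) \<le> c t * e t + \<phi> t"
  shows "e (Suc t) \<le> (\<Prod>i\<in>{0..t}. c i) * e 0 + (\<Sum>i\<in>{0..t}. (\<Prod>k\<in>{i + 1..t}. c k) * \<phi> i)"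
proof (induction t)
  case 0
  then show ?case using step[of 0] by simp
next
  case (Suc t)
  have "e (Suc (Suc t)) \<le> c (Suc t) * e (Suc t) + \<phi> (Suc t)" by (rule step)
  also have "c (Suc t) * e (Suc t) \<le> c (Suc t) *
      ((\<Prod>i\<in>{0..t}. c i) * e 0 + (\<Sum>i\<in>{0..t}. (\<Prod>k\<in>{i + 1..t}. c k) * \<phi> i))"
    by (rule mult_left_mono[OF Suc.IH c])
  also have "\<dots> = (\<Prod>i\<in>{0..Suc t}. c i) * e 0 + (\<Sum>i\<in>{0..t}. (\<Prod>k\<in>{i + 1..Suc t}. c k) * \<phi> i)"
    by (simp add: distrib_left sum_distrib_left mult_ac)
  \<comment> \<open>The factor \<open>c (Suc t)\<close> has joined the product of every earlier
    drift; the newest drift enters with an empty product.\<close>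
  finally show ?case by simp
qed

text \<open>Measured from the fixed point \<open>F\<close> of the affine map, the error is dominated
  by a geometric sequence.\<close>

lemma limsup_affine_recursion_le:
  fixes e :: "nat \<Rightarrow> real"
  assumes L: "0 \<le> L" "L < 1" and step: "\<And>t. e (Suc t) \<le> L * e t + \<Phi>"
  shows "limsup (\<lambda>t. ereal (e t)) \<le> ereal (\<Phi> / (1 - L))"
proof -
  define F where "F = \<Phi> / (1 - L)"
  have F: "L * F + \<Phi> = F" using L by (simp add: F_def field_simps)
  have "e t - F \<le> L ^ t * (e 0 - F)" for t
  proof (induction t)
    case (Suc t)
    have "e (Suc t) - F \<le> L * (e t - F)"
      using step[of t] F by (simp add: algebra_simps)
    also have "\<dots> \<le> L * (L ^ t * (e 0 - F))"
      by (rule mult_left_mono[OF Suc.IH L(1)])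
    finally show ?case by (simp add: mult.assoc)
  qed simp
  then have "limsup (\<lambda>t. ereal (e t)) \<le> limsup (\<lambda>t. ereal (L ^ t * (e 0 - F) + F))"
    by (intro Limsup_mono always_eventually allI) (simp add: algebra_simps)
  also have "(\<lambda>t. L ^ t * (e 0 - F) + F) \<longlonglongrightarrow> 0 * (e 0 - F) + F"
    using L by (intro tendsto_intros LIMSEQ_realpow_zero) auto
  then have "limsup (\<lambda>t. ereal (L ^ t * (e 0 - F) + F)) = ereal F"
    by (intro lim_imp_Limsup) (simp_all add: tendsto_ereal)
  finally show ?thesis by (simp add: F_def)
qed

text \<open>Extended reals admit unbounded drift: the right side is then infinite, since
  \<open>1 - L\<close> is positive. Otherwise replacing \<open>c t\<close> and
  \<open>\<phi> t\<close> by their suprema leaves an affine recursion.\<close>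

lemma limsup_perturbed_contraction_le:
  fixes c e \<phi> :: "nat \<Rightarrow> real"
  assumes c: "\<And>t. 0 \<le> c t" "\<And>t. c t \<le> r" and r: "r < 1"
    and e: "\<And>t. 0 \<le> e t" and \<phi>: "\<And>t. 0 \<le> \<phi> t"
    and step: "\<And>t. e (Suc t) \<le> c t * e t + \<phi> t"
  shows "limsup (\<lambda>t. ereal (e t)) \<le> inverse (1 - (SUP t. ereal (c t))) * (SUP t. ereal (\<phi> t))"
proof -
  have "(SUP t. ereal (c t)) \<le> ereal r" "ereal 0 \<le> (SUP t. ereal (c t))"
    using c by (auto intro!: SUP_least SUP_upper2[of 0])
  then obtain L where L: "(SUP t. ereal (c t)) = ereal L" "0 \<le> L" "L < 1"
    using r by (cases "SUP t. ereal (c t)") auto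
  have cL: "c t \<le> L" for t
    using SUP_upper[of t UNIV "\<lambda>t. ereal (c t)"] L by simp
  have "ereal 0 \<le> (SUP t. ereal (\<phi> t))"
    using \<phi> by (auto intro!: SUP_upper2[of 0])
  then show ?thesis
  proof (cases "SUP t. ereal (\<phi> t)")
    case (real \<Phi>)
    have "e (Suc t) \<le> L * e t + \<Phi>" for t
      using step[of t] mult_right_mono[OF cL e, of t t] SUP_upper[of t UNIV "\<lambda>t. ereal (\<phi> t)"] real
      by simp
    from limsup_affine_recursion_le[where e = e and \<Phi> = \<Phi>, OF L(2,3) this] show ?thesis
      using L by (simp add: real one_ereal_def divide_inverse mult.commute)
  next
    case PInf
    then show ?thesis using L by (simp add: one_ereal_def)
  qed simp
qed

text \<open>The lower end of \<open>stepsize_range\<close> controls the branch \<open>1 - \<eta> * \<alpha>\<close> of the maximum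
  of absolute values, the upper end the branch \<open>\<eta> * \<beta> - 1\<close>; for \<open>\<alpha> \<le> \<beta>\<close> these dominate.\<close>

lemma contraction_factor_le:
  fixes \<alpha> :: real
  assumes \<alpha>: "0 < \<alpha>" "\<alpha> \<le> \<beta>" and \<epsilon>: "0 \<le> \<epsilon>" "\<beta> * \<epsilon> < \<alpha>" and \<eta>: "0 \<le> \<eta>"
    and range: "\<eta> \<in> stepsize_range r \<alpha> \<beta> \<epsilon>"
  shows "max \<bar>1 - \<eta> * \<alpha>\<bar> \<bar>1 - \<eta> * \<beta>\<bar> + \<eta> * \<beta> * \<epsilon> \<le> r"
proof -
  have "1 - r \<le> \<eta> * (\<alpha> - \<beta> * \<epsilon>)"
    using range \<epsilon> by (simp add: stepsize_range_def pos_divide_le_eq)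
  moreover have "\<eta> * (\<beta> * (1 + \<epsilon>)) \<le> 1 + r"
    using range \<alpha> \<epsilon> by (simp add: stepsize_range_def pos_le_divide_eq)
  moreover have "\<eta> * \<alpha> \<le> \<eta> * \<beta>" using \<alpha> \<eta> by (intro mult_left_mono)
  ultimately show ?thesis by (simp add: algebra_simps max_def abs_if)
qed

text \<open>After time 0, \<open>x t\<close> has been projected onto the constraint set of the
  previous time and may lie outside \<open>C t\<close>. The assumption
  \<open>iterates_admissible\<close> ensures that expectations under \<open>D t (x t)\<close> see
  only outcomes, where the loss is meaningful.\<close>

theorem mainTheorem1:
  fixes D :: "nat \<Rightarrow> real ^ 'd \<Rightarrow> 'm::polish_space measure"
    and C :: "nat \<Rightarrow> (real ^ 'd) set"
    and l :: "nat \<Rightarrow> real ^ 'd \<Rightarrow> 'm \<Rightarrow> real"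
    and \<alpha> \<beta> \<epsilon> \<eta> :: "nat \<Rightarrow> real"
    and x xbar :: "nat \<Rightarrow> real ^ 'd"
  assumes D: "\<And>t u. D t u \<in> radon_prob1"
    and differentiable: "\<And>t z u. z \<in> outcomes (D t) (C t) \<Longrightarrow> (\<lambda>v. l t v z) differentiable (at u)"
    and interchange: "\<And>t. interchangeable (D t) (C t) (l t)"
    and strong_convexity:
      "\<And>t. \<alpha> t > 0"
      "\<And>t z. z \<in> outcomes (D t) (C t) \<Longrightarrow> strongly_convex (\<alpha> t) (\<lambda>u. l t u z)"
    and smoothness:
      "\<And>t z. z \<in> outcomes (D t) (C t) \<Longrightarrow>
         (\<beta> t)-lipschitz_on UNIV (\<lambda>u. gradient (\<lambda>v. l t v z) u)"
      "\<And>t u. (\<beta> t)-lipschitz_on (outcomes (D t) (C t)) (\<lambda>z. gradient (\<lambda>v. l t v z) u)"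
    and sensitivity:
      "\<And>t. \<epsilon> t > 0"
      "\<And>t u u'. wasserstein1 (D t u) (D t u') \<le> \<epsilon> t * norm (u - u')"
    and constraints: "\<And>t. closed (C t)" "\<And>t. convex (C t)"
    and contraction: "\<And>t. \<epsilon> t * \<beta> t / \<alpha> t < 1"
    and stepsizes: "\<And>t. \<eta> t > 0"
    and iterates_admissible: "\<And>t. measure_support (D t (x t)) \<subseteq> outcomes (D t) (C t)"
    and iterates:
      "\<And>t. x (Suc t) = closest_point (C t)
         (x t - \<eta> t *\<^sub>R gradient (\<lambda>u. expected_loss (l t) u (D t (x t))) (x t))"
    and stable: "\<And>t. performatively_stable (D t) (C t) (l t) (xbar t)"
  shows
    "let e = (\<lambda>t. norm (x t - xbar t));
         \<phi> = (\<lambda>t. norm (xbar (Suc t) - xbar t));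
         \<rho> = (\<lambda>t. max \<bar>1 - \<eta> t * \<alpha> t\<bar> \<bar>1 - \<eta> t * \<beta> t\<bar>);
         a = (\<lambda>t. \<Prod>i\<in>{0..t}. \<rho> i + \<eta> i * \<beta> i * \<epsilon> i);
         b = (\<lambda>t i. if i = t then 1 else \<Prod>k\<in>{i + 1..t}. \<rho> k + \<eta> k * \<beta> k * \<epsilon> k);
         lam = (SUP t. ereal (\<rho> t + \<eta> t * \<beta> t * \<epsilon> t));
         phi_sup = (SUP t. ereal (\<phi> t))
     in (\<forall>t. e (Suc t) \<le> a t * e 0 + (\<Sum>i\<in>{0..t}. b t i * \<phi> i)) \<and>
        (\<forall>r. 0 < r \<and> r < 1 \<and> (\<forall>t. \<eta> t \<in> stepsize_range r (\<alpha> t) (\<beta> t) (\<epsilon> t)) \<longrightarrow>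
           lam \<le> ereal r \<and>
           limsup (\<lambda>t. ereal (e t)) \<le> inverse (1 - lam) * phi_sup)"
proof -
  have problem: "performative_problem (D t) (C t) (l t) (\<alpha> t) (\<beta> t)" for t
    by (unfold_locales) (use D interchange strong_convexity(2) smoothness in blast)+
  define c where "c t = max \<bar>1 - \<eta> t * \<alpha> t\<bar> \<bar>1 - \<eta> t * \<beta> t\<bar> + \<eta> t * \<beta> t * \<epsilon> t" for t
  define e where "e t = norm (x t - xbar t)" for t
  define \<phi> where "\<phi> t = norm (xbar (Suc t) - xbar t)" for t
  have \<eta>: "0 \<le> \<eta> t" and \<epsilon>: "0 \<le> \<epsilon> t" for t
    using stepsizes[of t] sensitivity(1)[of t] by simp_all
  have c_nonneg: "0 \<le> c t" for t
    using \<eta>[of t] \<epsilon>[of t] performative_problem.beta_nonneg[OF problem[of t]]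
    by (auto simp: c_def intro!: add_nonneg_nonneg mult_nonneg_nonneg)
  have step: "e (Suc t) \<le> c t * e t + \<phi> t" for t
  proof -
    have "norm (x (Suc t) - xbar t) \<le> c t * e t"
      unfolding iterates c_def e_def
      by (rule performative_problem.projected_gradient_step[OF problem constraints \<eta>
            sensitivity(2) iterates_admissible stable])
    \<comment> \<open>The step approaches the old stable point; passing to the new one costs the
      drift.\<close>
    moreover have "e (Suc t) \<le> norm (x (Suc t) - xbar t) + \<phi> t"
      unfolding e_def \<phi>_def
      using norm_triangle_ineq4[of "x (Suc t) - xbar t" "xbar (Suc t) - xbar t"] by simp
    ultimately show ?thesis by linarith
  qed
  have bound: "e (Suc t) \<le> (\<Prod>i\<in>{0..t}. c i) * e 0
      + (\<Sum>i\<in>{0..t}. (if i = t then 1 else \<Prod>k\<in>{i + 1..t}. c k) * \<phi> i)" for t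
  proof -
    \<comment> \<open>The separate case \<open>i = t\<close> agrees with the product over an empty
      range.\<close>
    have "(\<Sum>i\<in>{0..t}. (\<Prod>k\<in>{i + 1..t}. c k) * \<phi> i)
        = (\<Sum>i\<in>{0..t}. (if i = t then 1 else \<Prod>k\<in>{i + 1..t}. c k) * \<phi> i)"
      by (intro sum.cong) auto
    with perturbed_recursion_bound[of c e \<phi> t, OF c_nonneg step] show ?thesis
      by (simp only:)
  qed
  have c_le: "c t \<le> r" if "\<eta> t \<in> stepsize_range r (\<alpha> t) (\<beta> t) (\<epsilon> t)" for t r
    unfolding c_def
  proof (rule contraction_factor_le)
    \<comment> \<open>The stable point witnesses that \<open>C t\<close> is nonempty.\<close>
    have "xbar t \<in> C t"
      using stable[of t] by (simp add: performatively_stable_def is_arg_min_def)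
    then show "\<alpha> t \<le> \<beta> t"
      using performative_problem.alpha_le_beta[OF problem] by blast
    show "\<beta> t * \<epsilon> t < \<alpha> t"
      using contraction[of t] strong_convexity(1)[of t] by (simp add: mult.commute)
  qed (use that strong_convexity \<epsilon> \<eta> in auto)
  have "(SUP t. ereal (c t)) \<le> ereal r \<and>
      limsup (\<lambda>t. ereal (e t)) \<le> inverse (1 - (SUP t. ereal (c t))) * (SUP t. ereal (\<phi> t))"
    if r: "r < 1" "\<And>t. \<eta> t \<in> stepsize_range r (\<alpha> t) (\<beta> t) (\<epsilon> t)" for r
    using limsup_perturbed_contraction_le[of c r e \<phi>, OF c_nonneg c_le[OF r(2)] r(1) _ _ step]
      c_le[OF r(2)] by (auto simp: e_def \<phi>_def intro!: SUP_least)
  with bound show ?thesis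
    unfolding Let_def c_def e_def \<phi>_def by blast
qed

end
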